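(* Let $n\ge3$ and $2^{n-3}<k\le 2^{n-2}$. Let $H_1,\dots,H_{h(n,k)}$ be representatives of the equivalence classes (under $B_n$) of spanned hyperplanes of $Q_n$ containing at least $k$ points of $V_n$, and for each $i$ let $A_i$ be the set of $0/1$-equivalence classes of $Q_n$ that contain some class of $\mathcal{P}(H_i,k)$. Fix $1\le i<j\le h(n,k)$, and let $H_i\cap w_1(H_j),\dots,H_i\cap w_m(H_j)$ be representatives of the equivalence classes (under $B_n$) of $E(H_i,H_j,k)$. Define $\Phi_3$ on the disjoint union $\bigsqcup_{s=1}^m\mathcal{P}(H_i\cap w_s(H_j),k)$ by sending a partial $0/1$-equivalence class to the unique $0/1$-equivalence class of $Q_n$ containing it. Then $\Phi_3$ is a bijection from this disjoint union onto $A_i\cap A_j$.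
   Context: $Q_n=[0,1]^n$, $V_n=\{0,1\}^n$. A $0/1$-polytope of $Q_n$ is the convex hull of a nonempty subset of $V_n$; it has $k$ vertices if the subset has $k$ elements. $B_n$ is the group of signed permutations $w$ of $\{1,\dots,n\}$ (underlying permutation $\pi$, sign $\pm$ on each $i$) acting on $\mathbb{R}^n$ by $w(x)_i=x_{\pi(i)}$ (sign $+$) or $1-x_{\pi(i)}$ (sign $-$), and on subsets by taking images; two subsets (polytopes, hyperplanes, intersections) are equivalent under $B_n$ if some $w\in B_n$ maps one onto the other, and $0/1$-equivalence classes of $Q_n$ are the classes of $0/1$-polytopes under this relation. A spanned hyperplane of $Q_n$ is a hyperplane $H$ such that the affine hull of $H\cap V_n$ is $H$. For $\mathcal S\subset\mathbb{R}^n$, the partial $0/1$-equivalence classes of $\mathcal S$ are the classes of $0/1$-polytopes contained in $\mathcal S$ under $P\sim P'$ iff $g(P)=P'$ for some $g\in B_n$, and $\mathcal{P}(\mathcal S,k)$ is the set of those with $k$ vertices. $E(H_i,H_j,k)$ is the set of intersections $H_i\cap w(H_j)$, $w\in B_n$, containing at least $k$ points of $V_n$. *)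

theory Defs
  imports "HOL-Analysis.Analysis"
begin

text \<open>The dimension \<open>n\<close> is \<open>CARD('n)\<close>; coordinates are indexed by the finite type \<open>'n\<close>.\<close>

definition cube_vertices :: "(real ^ 'n) set" where
  "cube_vertices = {x. \<forall>i. x $ i = 0 \<or> x $ i = 1}"

definition has_vertex_count :: "(real ^ 'n) set \<Rightarrow> nat \<Rightarrow> bool" where
  "has_vertex_count P k \<longleftrightarrow>
     (\<exists>S. S \<subseteq> cube_vertices \<and> S \<noteq> {} \<and> P = convex hull S \<and> card S = k)"

definition zero_one_polytopes :: "(real ^ 'n) set set" where
  "zero_one_polytopes = {convex hull S | S. S \<subseteq> cube_vertices \<and> S \<noteq> {}}"

text \<open>A signed permutation is a pair of its underlying permutation and its signs,
  where \<open>True\<close> stands for the sign \<open>+\<close>.\<close>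

type_synonym 'n sperm = "('n \<Rightarrow> 'n) \<times> ('n \<Rightarrow> bool)"

definition signed_perms :: "'n sperm set" where
  "signed_perms = {(\<pi>, \<epsilon>). bij \<pi>}"

definition act :: "'n sperm \<Rightarrow> real ^ 'n \<Rightarrow> real ^ 'n" where
  "act w x = (\<chi> i. if snd w i then x $ fst w i else 1 - x $ fst w i)"

text \<open>Equivalence of subsets of space under signed permutations, restricted to a family
  \<open>\<A>\<close>, which need not be invariant under the action.\<close>

definition equiv_on :: "(real ^ 'n) set set \<Rightarrow> (real ^ 'n) set rel" where
  "equiv_on \<A> = {(X, Y). X \<in> \<A> \<and> Y \<in> \<A> \<and> (\<exists>w\<in>signed_perms. act w ` X = Y)}"

definition representatives :: "(real ^ 'n) set set \<Rightarrow> nat \<Rightarrow> (nat \<Rightarrow> (real ^ 'n) set) \<Rightarrow> bool" where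
  "representatives \<A> m F \<longleftrightarrow>
     (\<forall>s\<in>{1..m}. F s \<in> \<A>) \<and>
     bij_betw (\<lambda>s. equiv_on \<A> `` {F s}) {1..m} (\<A> // equiv_on \<A>)"

definition partial_classes :: "(real ^ 'n) set \<Rightarrow> (real ^ 'n) set set set" where
  "partial_classes S =
     {P \<in> zero_one_polytopes. P \<subseteq> S} // equiv_on {P \<in> zero_one_polytopes. P \<subseteq> S}"

definition zero_one_classes :: "(real ^ 'n) set set set" where
  "zero_one_classes = zero_one_polytopes // equiv_on zero_one_polytopes"

definition partial_classes_card :: "(real ^ 'n) set \<Rightarrow> nat \<Rightarrow> (real ^ 'n) set set set" where
  "partial_classes_card S k = {C \<in> partial_classes S. \<forall>P\<in>C. has_vertex_count P k}"

definition spanned_hyperplane :: "(real ^ 'n) set \<Rightarrow> bool" where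
  "spanned_hyperplane H \<longleftrightarrow>
     (\<exists>a b. a \<noteq> 0 \<and> H = {x. a \<bullet> x = b}) \<and> affine hull (H \<inter> cube_vertices) = H"

definition rich_hyperplanes :: "nat \<Rightarrow> (real ^ 'n) set set" where
  "rich_hyperplanes k = {H. spanned_hyperplane H \<and> k \<le> card (H \<inter> cube_vertices)}"

definition induced_classes :: "(real ^ 'n) set \<Rightarrow> nat \<Rightarrow> (real ^ 'n) set set set" where
  "induced_classes H k = {D \<in> zero_one_classes. \<exists>C\<in>partial_classes_card H k. C \<subseteq> D}"

definition intersections ::
    "(real ^ 'n) set \<Rightarrow> (real ^ 'n) set \<Rightarrow> nat \<Rightarrow> (real ^ 'n) set set" where
  "intersections H H' k =
     {H \<inter> act w ` H' | w. w \<in> signed_perms \<and> k \<le> card ((H \<inter> act w ` H') \<inter> cube_vertices)}"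

definition Phi3 :: "nat \<times> (real ^ 'n) set set \<Rightarrow> (real ^ 'n) set set" where
  "Phi3 = (\<lambda>(s, C). THE D. D \<in> zero_one_classes \<and> C \<subseteq> D)"


lemma act_id: "act (id, \<lambda>_. True) x = x"
  by (simp add: act_def)

lemma act_comp:
  "act w (act v x) = act (fst v \<circ> fst w, \<lambda>i. snd w i = snd v (fst w i)) x"
  by (simp add: act_def vec_eq_iff)

lemma act_inverse:
  assumes "w \<in> signed_perms"
  obtains v where "v \<in> signed_perms" "\<And>x. act v (act w x) = x"
proof -
  obtain p e where w: "w = (p, e)" "bij p" using assms by (auto simp: signed_perms_def)
  have "p (inv p i) = i" for i using w(2) by (simp add: bij_is_surj surj_f_inv_f)
  then have "act (inv p, \<lambda>i. e (inv p i)) (act w x) = x" for x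
    by (simp add: act_def vec_eq_iff w)
  moreover have "(inv p, \<lambda>i. e (inv p i)) \<in> signed_perms"
    using w(2) by (simp add: signed_perms_def bij_imp_bij_inv)
  ultimately show ?thesis using that by blast
qed

lemma equiv_equiv_on: "equiv \<A> (equiv_on \<A>)"
proof (rule equivI)
  show "equiv_on \<A> \<subseteq> \<A> \<times> \<A>" by (auto simp: equiv_on_def)
  have "(id, \<lambda>_. True) \<in> (signed_perms :: 'a sperm set)" by (simp add: signed_perms_def)
  moreover have "act (id, \<lambda>_. True) ` X = X" for X :: "(real ^ 'a) set"
    by (simp add: act_id)
  ultimately show "refl_on \<A> (equiv_on \<A>)"
    unfolding refl_on_def equiv_on_def by blast
  show "sym (equiv_on \<A>)"
  proof (rule symI)
    fix X Y assume "(X, Y) \<in> equiv_on \<A>"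
    then obtain w where w: "X \<in> \<A>" "Y \<in> \<A>" "w \<in> signed_perms" "Y = act w ` X"
      by (auto simp: equiv_on_def)
    obtain v where v: "v \<in> signed_perms" "\<And>x. act v (act w x) = x"
      using act_inverse[OF w(3)] by blast
    have "act v ` Y = X" by (simp add: w(4) image_image v(2))
    then show "(Y, X) \<in> equiv_on \<A>" using w v by (auto simp: equiv_on_def)
  qed
  show "trans (equiv_on \<A>)"
  proof (rule transI)
    fix X Y Z assume "(X, Y) \<in> equiv_on \<A>" "(Y, Z) \<in> equiv_on \<A>"
    then obtain v w where *: "X \<in> \<A>" "Z \<in> \<A>" "v \<in> signed_perms" "w \<in> signed_perms"
      "Z = act w ` act v ` X" by (auto simp: equiv_on_def)
    let ?u = "(fst v \<circ> fst w, \<lambda>i. snd w i = snd v (fst w i))"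
    have "?u \<in> signed_perms" using *(3,4) by (auto simp: signed_perms_def bij_comp)
    moreover have "act ?u ` X = Z" by (simp only: *(5) image_image act_comp)
    ultimately show "(X, Z) \<in> equiv_on \<A>" using *(1,2) unfolding equiv_on_def by blast
  qed
qed

text \<open>The description in \<^const>\<open>Phi3\<close> determines a class.\<close>

lemma partial_class_in_unique_class:
  assumes "C \<in> partial_classes S"
  shows "\<exists>!D. D \<in> zero_one_classes \<and> C \<subseteq> D"
proof -
  let ?B = "{P \<in> zero_one_polytopes. P \<subseteq> S}"
  obtain P where P: "P \<in> ?B" "C = equiv_on ?B `` {P}"
    using assms unfolding partial_classes_def by (rule quotientE)
  have PC: "P \<in> C" using equiv_class_self[OF equiv_equiv_on P(1)] P(2) by simp
  let ?D = "equiv_on zero_one_polytopes `` {P}"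
  have Pz: "P \<in> zero_one_polytopes" using P(1) by simp
  have D1: "?D \<in> zero_one_classes" unfolding zero_one_classes_def by (rule quotientI[OF Pz])
  have D2: "C \<subseteq> ?D" unfolding P(2) equiv_on_def by auto
  have uniq: "D' = ?D" if "D' \<in> zero_one_classes" "C \<subseteq> D'" for D'
  proof -
    have "D' = ?D \<or> D' \<inter> ?D = {}"
      using quotient_disj[OF equiv_equiv_on] that(1) D1 unfolding zero_one_classes_def by auto
    with PC D2 that(2) show ?thesis by auto
  qed
  show ?thesis
  proof (rule ex1I[of _ ?D])
    show "?D \<in> zero_one_classes \<and> C \<subseteq> ?D" using D1 D2 by (rule conjI)
    fix D' assume "D' \<in> zero_one_classes \<and> C \<subseteq> D'"
    then show "D' = ?D" using uniq[of D'] by (elim conjE)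
  qed
qed

lemma vertex_count_unique:
  assumes "has_vertex_count P k" "has_vertex_count P l"
  shows "k = l"
proof -
  have *: "convex hull S \<inter> cube_vertices = S" if S: "S \<subseteq> cube_vertices" for S :: "(real ^ 'a) set"
  proof
    show "S \<subseteq> convex hull S \<inter> cube_vertices" using S hull_subset[of S convex] by (rule Int_greatest[rotated])
    show "convex hull S \<inter> cube_vertices \<subseteq> S"
    proof
      fix x assume x: "x \<in> convex hull S \<inter> cube_vertices"
      show "x \<in> S"
      proof (rule ccontr)
        assume xS: "x \<notin> S"
        let ?a = "(\<chi> i. 2 * x $ i - 1) :: real ^ 'a"
        have "?a \<bullet> y < ?a \<bullet> x" if y: "y \<in> S" for y
        proof -
          have yv: "y \<in> cube_vertices" "y \<noteq> x" using y S xS by auto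
          then obtain j where j: "y $ j \<noteq> x $ j" by (auto simp: vec_eq_iff)
          have c: "(x $ i = 0 \<or> x $ i = 1) \<and> (y $ i = 0 \<or> y $ i = 1)" for i
            using x yv by (auto simp: cube_vertices_def)
          have "(2 * x $ i - 1) * y $ i \<le> (2 * x $ i - 1) * x $ i" for i
            using c[of i] by auto
          moreover have "(2 * x $ j - 1) * y $ j < (2 * x $ j - 1) * x $ j"
            using c[of j] j by auto
          ultimately have "(\<Sum>i\<in>UNIV. (2 * x $ i - 1) * y $ i) < (\<Sum>i\<in>UNIV. (2 * x $ i - 1) * x $ i)"
            by (intro sum_strict_mono_ex1 ballI bexI[of _ j]) simp_all
          then show ?thesis by (simp add: inner_vec_def)
        qed
        then have "convex hull S \<subseteq> {y. ?a \<bullet> y < ?a \<bullet> x}"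
          by (intro hull_minimal) (auto simp: convex_halfspace_lt)
        with x show False by auto
      qed
    qed
  qed
  show ?thesis
  proof -
    obtain S T where S: "S \<subseteq> cube_vertices" "P = convex hull S" "card S = k"
      and T: "T \<subseteq> cube_vertices" "P = convex hull T" "card T = l"
      using assms unfolding has_vertex_count_def by (elim exE conjE) (rule that)
    have "S = P \<inter> cube_vertices" "T = P \<inter> cube_vertices"
      using *[OF S(1)] *[OF T(1)] S(2) T(2) by simp_all
    with S(3) T(3) show ?thesis by simp
  qed
qed

end

theory Submission imports Defs
begin

text \<open>An affine subspace of dimension \<open>d\<close> contains at most \<open>2 ^ d\<close> cube vertices. Two inequivalent
  spanned hyperplanes meet in dimension at most \<open>n - 2\<close>, so a \<open>0/1\<close>-polytope with more than
  \<open>2 ^ (n - 3)\<close> vertices in this intersection determines it as its affine hull. Hence equivalent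
  such polytopes lie in equivalent intersections, which gives injectivity; surjectivity amounts
  to moving a polytope of \<open>H\<^sub>j\<close> into \<open>H\<^sub>i\<close> by a signed permutation.\<close>

section \<open>Cube vertices in affine subspaces\<close>

lemma finite_cube_vertices: "finite (cube_vertices :: (real ^ 'n) set)"
proof (rule finite_subset)
  show "cube_vertices \<subseteq> range (\<lambda>f. (\<chi> i. if f i then 1 else 0) :: real ^ 'n)"
  proof
    fix x :: "real ^ 'n" assume "x \<in> cube_vertices"
    then have "x = (\<chi> i. if x $ i = 1 then 1 else 0)"
      by (auto simp: cube_vertices_def vec_eq_iff)
    then show "x \<in> range (\<lambda>f. (\<chi> i. if f i then 1 else 0) :: real ^ 'n)"
      by (rule range_eqI[where x = "\<lambda>i. x $ i = 1"])
  qed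
qed simp

text \<open>Induction on \<open>d\<close>, slicing along a coordinate: every cube vertex has
  \<open>l\<close>-th entry 0 or 1, so two parallel slices of \<open>A\<close> contain all its cube
  vertices, and each slice has smaller dimension.\<close>

lemma card_affine_Int_cube_vertices:
  fixes A :: "(real ^ 'n) set"
  assumes "affine A" "aff_dim A \<le> int d"
  shows "card (A \<inter> cube_vertices) \<le> 2 ^ d"
  using assms
proof (induction d arbitrary: A)
  case 0
  then have "aff_dim A = -1 \<or> aff_dim A = 0" using aff_dim_geq[of A] by auto
  then have "A = {} \<or> (\<exists>a. A = {a})" by (simp add: aff_dim_empty aff_dim_eq_0)
  then have "\<exists>a. A \<inter> cube_vertices \<subseteq> {a}" by auto
  then show ?case by (metis card_mono card.empty card.insert empty_iff finite.emptyI finite_insert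
        One_nat_def power_0)
next
  case (Suc d)
  show ?case
  proof (cases "\<exists>x\<in>A \<inter> cube_vertices. \<exists>y\<in>A \<inter> cube_vertices. x \<noteq> y")
    case False
    then have "card (A \<inter> cube_vertices) \<le> 1"
      by (metis card_le_Suc0_iff_eq finite_Int finite_cube_vertices One_nat_def)
    also have "(1 :: nat) \<le> 2 ^ Suc d" by simp
    finally show ?thesis .
  next
    case True
    then obtain x y l where xy: "x \<in> A" "y \<in> A" "x $ l \<noteq> y $ l"
      by (auto simp: vec_eq_iff)
    \<comment> \<open>Two points of \<open>A\<close> differ in coordinate \<open>l\<close>, so
      \<open>A\<close> lies in no \<open>F c\<close>, and intersecting with \<open>F c\<close>
      lowers the dimension.\<close>
    define F where "F c = {z :: real ^ 'n. axis l 1 \<bullet> z = c}" for c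
    have F: "z \<in> F c \<longleftrightarrow> z $ l = c" for z c
      by (simp add: F_def inner_axis')
    have "card ((A \<inter> F c) \<inter> cube_vertices) \<le> 2 ^ d" for c
    proof (rule Suc.IH)
      show "affine (A \<inter> F c)"
        using Suc.prems(1) unfolding F_def by (intro affine_Int affine_hyperplane)
      have "\<not> A \<subseteq> F c" using xy F by (metis subsetD)
      then show "aff_dim (A \<inter> F c) \<le> int d"
        using Suc.prems unfolding F_def by (simp add: aff_dim_affine_Int_hyperplane)
    qed
    from this[of 0] this[of 1]
    have "card ((A \<inter> F 0) \<inter> cube_vertices) + card ((A \<inter> F 1) \<inter> cube_vertices) \<le> 2 ^ Suc d"
      by simp
    moreover have "A \<inter> cube_vertices
        = ((A \<inter> F 0) \<inter> cube_vertices) \<union> ((A \<inter> F 1) \<inter> cube_vertices)"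
      by (auto simp: F cube_vertices_def)
    ultimately show ?thesis by (metis card_Un_le le_trans)
  qed
qed

section \<open>Signed permutations as affine maps\<close>

lemma linear_act_part: "linear (\<lambda>x. act w x - act w 0)"
  by (rule linearI) (auto simp: act_def vec_eq_iff algebra_simps)

text \<open>A negative sign contributes \<open>1 - x\<close>, so \<open>act w\<close> is in general
  affine but not linear. Splitting off the translation by \<open>act w 0\<close> makes the hull and
  dimension rules for linear images and translations applicable.\<close>

lemma act_image: "act w ` S = (+) (act w 0) ` (\<lambda>x. act w x - act w 0) ` S"
  by (simp add: image_image)

lemma inj_act:
  assumes "w \<in> signed_perms"
  shows "inj (act w)"
  using act_inverse[OF assms] by (metis injI)

lemma convex_hull_act: "convex hull (act w ` S) = act w ` (convex hull S)"
  by (simp only: act_image[of w] convex_hull_translation convex_hull_linear_image[OF linear_act_part])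

lemma affine_hull_act: "affine hull (act w ` S) = act w ` (affine hull S)"
  by (simp only: act_image[of w] affine_hull_translation
      affine_hull_linear_image[OF linear_conv_bounded_linear[THEN iffD1, OF linear_act_part]])

lemma affine_act: "affine S \<Longrightarrow> affine (act w ` S)"
  by (metis affine_hull_act affine_hull_eq)

lemma aff_dim_act:
  assumes "w \<in> signed_perms"
  shows "aff_dim (act w ` S) = aff_dim S"
proof -
  have "inj (\<lambda>x. act w x - act w 0)" using inj_act[OF assms] by (simp add: inj_def)
  then show ?thesis
    by (simp only: act_image[of w] aff_dim_translation_eq
        aff_dim_injective_linear_image[OF linear_act_part])
qed

lemma act_cube_vertices: "x \<in> cube_vertices \<Longrightarrow> act w x \<in> cube_vertices"
  by (auto simp: cube_vertices_def act_def)

lemma has_vertex_count_act: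
  assumes "w \<in> signed_perms" "has_vertex_count P k"
  shows "has_vertex_count (act w ` P) k"
proof -
  obtain S where S: "S \<subseteq> cube_vertices" "S \<noteq> {}" "P = convex hull S" "card S = k"
    using assms(2) by (auto simp: has_vertex_count_def)
  have "card (act w ` S) = k"
    using S(4) inj_act[OF assms(1)] by (metis card_image inj_on_subset subset_UNIV)
  moreover have "act w ` S \<subseteq> cube_vertices" using S(1) by (auto intro: act_cube_vertices)
  ultimately show ?thesis
    using S(2,3) unfolding has_vertex_count_def by (metis convex_hull_act image_is_empty)
qed

lemma has_vertex_count_polytope: "has_vertex_count P k \<Longrightarrow> P \<in> zero_one_polytopes"
  by (auto simp: has_vertex_count_def zero_one_polytopes_def)

lemma has_vertex_count_card_le:
  assumes "has_vertex_count P k" "P \<subseteq> A"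
  shows "k \<le> card (A \<inter> cube_vertices)"
proof -
  obtain S where S: "S \<subseteq> cube_vertices" "P = convex hull S" "card S = k"
    using assms(1) by (auto simp: has_vertex_count_def)
  have "S \<subseteq> A \<inter> cube_vertices"
    using S(1,2) assms(2) hull_subset[of S convex] by simp
  then show ?thesis
    unfolding S(3)[symmetric] by (intro card_mono finite_Int disjI2 finite_cube_vertices)
qed

text \<open>The affine hull of \<open>P\<close> contains at least \<open>k\<close> cube vertices;
  with dimension at most \<open>d\<close> it could contain only \<open>2 ^ d\<close>.\<close>

lemma aff_dim_of_vertex_count:
  fixes P :: "(real ^ 'n) set"
  assumes "has_vertex_count P k" "2 ^ d < k"
  shows "int d < aff_dim P"
proof (rule ccontr)
  assume "\<not> int d < aff_dim P"
  then have "card (affine hull P \<inter> cube_vertices) \<le> 2 ^ d"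
    by (intro card_affine_Int_cube_vertices) simp_all
  then show False
    using has_vertex_count_card_le[OF assms(1) hull_subset[of P affine]] assms(2) by simp
qed

section \<open>Equivalence classes in terms of representing polytopes\<close>

abbreviation polytopes_in :: "(real ^ 'n) set \<Rightarrow> (real ^ 'n) set set" where
  "polytopes_in S \<equiv> {P \<in> zero_one_polytopes. P \<subseteq> S}"

text \<open>Signed permutations preserve the number of vertices, so a class all of whose members
  have \<open>k\<close> vertices is the same as the class of one such polytope.\<close>

lemma partial_classes_card_eq:
  "partial_classes_card S k =
     (\<lambda>P. equiv_on (polytopes_in S) `` {P}) ` {P. has_vertex_count P k \<and> P \<subseteq> S}"
proof (intro equalityI subsetI)
  fix C assume C: "C \<in> partial_classes_card S k"
  then obtain P where P: "P \<in> polytopes_in S" "C = equiv_on (polytopes_in S) `` {P}"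
    unfolding partial_classes_card_def partial_classes_def by (auto elim: quotientE)
  then have "P \<in> C" using equiv_class_self[OF equiv_equiv_on P(1)] by simp
  then show "C \<in> (\<lambda>P. equiv_on (polytopes_in S) `` {P}) ` {P. has_vertex_count P k \<and> P \<subseteq> S}"
    using C P unfolding partial_classes_card_def by auto
next
  fix C assume "C \<in> (\<lambda>P. equiv_on (polytopes_in S) `` {P}) ` {P. has_vertex_count P k \<and> P \<subseteq> S}"
  then obtain P where P: "has_vertex_count P k" "P \<subseteq> S" "C = equiv_on (polytopes_in S) `` {P}"
    by auto
  have "C \<in> partial_classes S"
    unfolding partial_classes_def P(3)
    by (intro quotientI) (simp add: P(2) has_vertex_count_polytope[OF P(1)])
  moreover have "\<forall>Q\<in>C. has_vertex_count Q k"
    using P(1) has_vertex_count_act by (auto simp: P(3) equiv_on_def)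
  ultimately show "C \<in> partial_classes_card S k" by (simp add: partial_classes_card_def)
qed

lemma zero_one_class_eq_iff:
  assumes "has_vertex_count P k" "has_vertex_count Q l"
  shows "equiv_on zero_one_polytopes `` {P} = equiv_on zero_one_polytopes `` {Q}
    \<longleftrightarrow> (\<exists>v\<in>signed_perms. act v ` P = Q)"
proof -
  have PQ: "P \<in> zero_one_polytopes" "Q \<in> zero_one_polytopes"
    using assms has_vertex_count_polytope by auto
  then show ?thesis
    unfolding eq_equiv_class_iff[OF equiv_equiv_on PQ] by (simp add: equiv_on_def)
qed

text \<open>Replaces the definite description by an explicit class: enlarging the family of
  polytopes only enlarges the class of \<open>P\<close>, and the full class containing a partial one
  is unique.\<close>

lemma Phi3_class:
  assumes "P \<in> polytopes_in S"
  shows "Phi3 (s, equiv_on (polytopes_in S) `` {P}) = equiv_on zero_one_polytopes `` {P}"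
proof -
  let ?C = "equiv_on (polytopes_in S) `` {P}" and ?D = "equiv_on zero_one_polytopes `` {P}"
  have C: "?C \<in> partial_classes S"
    unfolding partial_classes_def using assms by (rule quotientI)
  have D: "?D \<in> zero_one_classes"
    unfolding zero_one_classes_def using assms by (intro quotientI) simp
  have CD: "?C \<subseteq> ?D" by (auto simp: equiv_on_def)
  show ?thesis
    unfolding Phi3_def prod.case
    by (rule the1_equality[OF partial_class_in_unique_class[OF C] conjI[OF D CD]])
qed

lemma induced_classes_eq:
  "induced_classes S k =
     (\<lambda>P. equiv_on zero_one_polytopes `` {P}) ` {P. has_vertex_count P k \<and> P \<subseteq> S}"
proof -
  \<comment> \<open>By uniqueness, containing the partial class of \<open>P\<close> pins
    \<open>D\<close> down, so the existential over partial classes becomes an image over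
    polytopes.\<close>
  have *: "D \<in> zero_one_classes \<and> equiv_on (polytopes_in S) `` {P} \<subseteq> D
      \<longleftrightarrow> D = equiv_on zero_one_polytopes `` {P}"
    if "has_vertex_count P k" "P \<subseteq> S" for P D
  proof -
    have P: "P \<in> polytopes_in S" using that by (simp add: has_vertex_count_polytope)
    have "equiv_on (polytopes_in S) `` {P} \<in> partial_classes S"
      unfolding partial_classes_def using P by (rule quotientI)
    moreover have "equiv_on zero_one_polytopes `` {P} \<in> zero_one_classes"
      unfolding zero_one_classes_def using P by (intro quotientI) simp
    moreover have "equiv_on (polytopes_in S) `` {P} \<subseteq> equiv_on zero_one_polytopes `` {P}"
      by (auto simp: equiv_on_def)
    ultimately show ?thesis using partial_class_in_unique_class by blast
  qed
  show ?thesis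
  proof (intro equalityI subsetI)
    fix D assume "D \<in> induced_classes S k"
    then obtain P where P: "has_vertex_count P k" "P \<subseteq> S"
      "D \<in> zero_one_classes" "equiv_on (polytopes_in S) `` {P} \<subseteq> D"
      unfolding induced_classes_def partial_classes_card_eq by (elim CollectE conjE bexE imageE) simp
    then have "D = equiv_on zero_one_polytopes `` {P}" using *[OF P(1,2), of D] by blast
    with P(1,2) show "D \<in> (\<lambda>P. equiv_on zero_one_polytopes `` {P}) ` {P. has_vertex_count P k \<and> P \<subseteq> S}"
      by simp
  next
    fix D assume "D \<in> (\<lambda>P. equiv_on zero_one_polytopes `` {P}) ` {P. has_vertex_count P k \<and> P \<subseteq> S}"
    then obtain P where P: "has_vertex_count P k" "P \<subseteq> S" "D = equiv_on zero_one_polytopes `` {P}"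
      by (elim imageE CollectE conjE)
    then have "D \<in> zero_one_classes" "equiv_on (polytopes_in S) `` {P} \<subseteq> D"
      using *[OF P(1,2), of D] by blast+
    moreover have "equiv_on (polytopes_in S) `` {P} \<in> partial_classes_card S k"
      unfolding partial_classes_card_eq using P(1,2) by (intro imageI CollectI conjI)
    ultimately show "D \<in> induced_classes S k"
      unfolding induced_classes_def by (intro CollectI conjI bexI)
  qed
qed

section \<open>Systems of representatives\<close>

lemma representatives_equivalent_imp_eq:
  assumes "representatives \<A> m F" "s \<in> {1..m}" "t \<in> {1..m}"
    and "v \<in> signed_perms" "act v ` F s = F t"
  shows "s = t"
proof -
  have "F s \<in> \<A>" "F t \<in> \<A>" and inj: "inj_on (\<lambda>s. equiv_on \<A> `` {F s}) {1..m}"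
    using assms(1-3) by (auto simp: representatives_def bij_betw_def)
  then have "(F s, F t) \<in> equiv_on \<A>" using assms(4,5) by (auto simp: equiv_on_def)
  then show ?thesis using inj_onD[OF inj] equiv_class_eq[OF equiv_equiv_on] assms(2,3) by blast
qed

lemma representatives_cover:
  assumes "representatives \<A> m F" "X \<in> \<A>"
  obtains s v where "s \<in> {1..m}" "v \<in> signed_perms" "act v ` X = F s"
proof -
  have "equiv_on \<A> `` {X} \<in> (\<lambda>s. equiv_on \<A> `` {F s}) ` {1..m}"
    using assms quotientI[OF assms(2)] by (simp add: representatives_def bij_betw_def)
  then obtain s where s: "s \<in> {1..m}" "equiv_on \<A> `` {X} = equiv_on \<A> `` {F s}" by auto
  have "F s \<in> \<A>" using assms(1) s(1) by (simp add: representatives_def)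
  then have "(X, F s) \<in> equiv_on \<A>"
    using eq_equiv_class_iff[OF equiv_equiv_on assms(2)] s(2) by blast
  then show ?thesis using that s(1) by (auto simp: equiv_on_def)
qed

text \<open>A nonempty intersection of full dimension would equal both \<open>A\<close> and
  \<open>B\<close>. The empty case is separate: dimension -1 then makes both sets empty.\<close>

lemma aff_dim_Int_less:
  assumes "affine A" "affine B" "aff_dim A = aff_dim B" "A \<noteq> B"
  shows "aff_dim (A \<inter> B) < aff_dim A"
proof (rule ccontr)
  assume "\<not> aff_dim (A \<inter> B) < aff_dim A"
  then have eq: "aff_dim (A \<inter> B) = aff_dim A" "aff_dim (A \<inter> B) = aff_dim B"
    using aff_dim_subset[of "A \<inter> B" A] assms(3) by auto
  show False
  proof (cases "A \<inter> B = {}")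
    case True
    then show False using eq assms(4) by (metis aff_dim_empty)
  next
    case False
    then have "A \<inter> B = A" "A \<inter> B = B"
      using affine_dim_equal[OF affine_Int[OF assms(1,2)] assms(1) False] eq(1)
        affine_dim_equal[OF affine_Int[OF assms(1,2)] assms(2) False] eq(2) by blast+
    then show False using assms(4) by simp
  qed
qed

theorem theorem8p4:
  fixes H :: "nat \<Rightarrow> (real ^ 'n) set"
    and w :: "nat \<Rightarrow> 'n sperm"
    and k h m i j :: nat
  assumes "3 \<le> CARD('n)"
    and "2 ^ (CARD('n) - 3) < k" and "k \<le> 2 ^ (CARD('n) - 2)"
    and "representatives (rich_hyperplanes k) h H"
    and "1 \<le> i" and "i < j" and "j \<le> h"
    and "\<forall>s\<in>{1..m}. w s \<in> signed_perms"
    and "representatives (intersections (H i) (H j) k) m (\<lambda>s. H i \<inter> act (w s) ` H j)"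
  shows "bij_betw Phi3
           (SIGMA s:{1..m}. partial_classes_card (H i \<inter> act (w s) ` H j) k)
           (induced_classes (H i) k \<inter> induced_classes (H j) k)"
proof -
  let ?n = "CARD('n)"
  let ?I = "\<lambda>s. H i \<inter> act (w s) ` H j"
  let ?cl = "\<lambda>P. equiv_on zero_one_polytopes `` {P}"
  let ?pcl = "\<lambda>s P. equiv_on (polytopes_in (?I s)) `` {P}"
  note reps = assms(9)
  have hyp: "affine (H l) \<and> aff_dim (H l) = int ?n - 1" if "l \<in> {i, j}" for l
  proof -
    have "l \<in> {1..h}" using that assms(5-7) by auto
    then have "H l \<in> rich_hyperplanes k" using assms(4) by (simp add: representatives_def)
    then show ?thesis
      by (auto simp: rich_hyperplanes_def spanned_hyperplane_def affine_hyperplane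
          aff_dim_hyperplane)
  qed
  \<comment> \<open>Distinct representatives are inequivalent, so no image of \<open>H j\<close> is
    \<open>H i\<close>.\<close>
  have ne: "H i \<noteq> act v ` H j" if "v \<in> signed_perms" for v
    using representatives_equivalent_imp_eq[OF assms(4) _ _ that, of j i] assms(5-7) by auto
  \<comment> \<open>Dimension squeeze: the intersection has dimension at most n - 2, while
    \<open>P\<close> inside it has dimension greater than n - 3. The truncated \<open>?n - 3\<close>
    is a true difference because n is at least 3.\<close>
  have aff_hull: "affine hull P = ?I s"
    if s: "s \<in> {1..m}" and P: "has_vertex_count P k" "P \<subseteq> ?I s" for s P
  proof (rule affine_dim_equal)
    have ws: "w s \<in> signed_perms" using assms(8) s by blast
    show aff: "affine (?I s)" using hyp by (intro affine_Int affine_act) simp_all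
    show "affine hull P \<noteq> {}"
      using P(1) by (auto simp: has_vertex_count_def)
    show sub: "affine hull P \<subseteq> ?I s" using P(2) aff by (rule hull_minimal)
    have "aff_dim (?I s) < int ?n - 1"
      using aff_dim_Int_less[of "H i" "act (w s) ` H j"] hyp affine_act[of "H j"] aff_dim_act[OF ws]
        ne[OF ws] by simp
    moreover have "int (?n - 3) < aff_dim P"
      using aff_dim_of_vertex_count[OF P(1) assms(2)] .
    ultimately show "aff_dim (affine hull P) = aff_dim (?I s)"
      using aff_dim_subset[OF P(2)] assms(1) by simp
  qed simp
  have Phi3: "Phi3 (s, ?pcl s P) = ?cl P" if "has_vertex_count P k" "P \<subseteq> ?I s" for s P
    using that by (intro Phi3_class) (simp add: has_vertex_count_polytope)
  show ?thesis
  proof (rule bij_betw_imageI)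
    show "inj_on Phi3 (SIGMA s:{1..m}. partial_classes_card (?I s) k)"
    proof (rule inj_onI, clarify)
      fix s C t D
      assume s: "s \<in> {1..m}" and t: "t \<in> {1..m}"
        and C: "C \<in> partial_classes_card (?I s) k" and D: "D \<in> partial_classes_card (?I t) k"
        and eq: "Phi3 (s, C) = Phi3 (t, D)"
      obtain P where P: "has_vertex_count P k" "P \<subseteq> ?I s" "C = ?pcl s P"
        using C by (auto simp: partial_classes_card_eq)
      obtain Q where Q: "has_vertex_count Q k" "Q \<subseteq> ?I t" "D = ?pcl t Q"
        using D by (auto simp: partial_classes_card_eq)
      have "?cl P = ?cl Q" using eq Phi3[OF P(1,2)] Phi3[OF Q(1,2)] P(3) Q(3) by simp
      then obtain v where v: "v \<in> signed_perms" "act v ` P = Q"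
        using zero_one_class_eq_iff[OF P(1) Q(1)] by auto
      \<comment> \<open>Both intersections are affine hulls of the polytopes, and \<open>v\<close>
        commutes with taking hulls; so the two are equivalent and have the same index.\<close>
      have "act v ` ?I s = ?I t"
        using aff_hull[OF s P(1,2)] aff_hull[OF t Q(1,2)] v(2) affine_hull_act[of v P] by simp
      then have st: "s = t"
        using representatives_equivalent_imp_eq[OF reps s t v(1)] by simp
      \<comment> \<open>With \<open>s = t\<close>, both polytopes lie in the same intersection, so
        \<open>v\<close> also witnesses their partial equivalence.\<close>
      then have "(P, Q) \<in> equiv_on (polytopes_in (?I s))"
        using P Q v by (auto simp: equiv_on_def has_vertex_count_polytope)
      then have "C = D" using equiv_class_eq[OF equiv_equiv_on] P(3) Q(3) st by simp
      with st show "s = t \<and> C = D" by simp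
    qed
    show "Phi3 ` (SIGMA s:{1..m}. partial_classes_card (?I s) k)
        = induced_classes (H i) k \<inter> induced_classes (H j) k"
    proof (intro equalityI subsetI)
      fix D assume "D \<in> Phi3 ` (SIGMA s:{1..m}. partial_classes_card (?I s) k)"
      then obtain s P where s: "s \<in> {1..m}" and P: "has_vertex_count P k" "P \<subseteq> ?I s"
        and D: "D = ?cl P"
        using Phi3 by (auto simp: partial_classes_card_eq)
      \<comment> \<open>Undoing \<open>w s\<close> carries \<open>P\<close> into \<open>H j\<close>
        without leaving its class, so \<open>D\<close> is also induced by
        \<open>H j\<close>.\<close>
      have "w s \<in> signed_perms" using assms(8) s by blast
      then obtain v where v: "v \<in> signed_perms" "\<And>x. act v (act (w s) x) = x"
        using act_inverse by blast
      have "act v ` P \<subseteq> H j" using P(2) v(2) by auto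
      moreover have vP: "has_vertex_count (act v ` P) k" using has_vertex_count_act[OF v(1) P(1)] .
      moreover have "D = ?cl (act v ` P)"
        unfolding D using zero_one_class_eq_iff[OF P(1) vP] v(1) by auto
      ultimately show "D \<in> induced_classes (H i) k \<inter> induced_classes (H j) k"
        using D P by (auto simp: induced_classes_eq)
    next
      fix D assume "D \<in> induced_classes (H i) k \<inter> induced_classes (H j) k"
      then obtain P Q where P: "has_vertex_count P k" "P \<subseteq> H i" "D = ?cl P"
        and Q: "has_vertex_count Q k" "Q \<subseteq> H j" "D = ?cl Q"
        by (auto simp: induced_classes_eq)
      obtain v where v: "v \<in> signed_perms" "act v ` Q = P"
        using zero_one_class_eq_iff[OF Q(1) P(1)] P(3) Q(3) by auto
      \<comment> \<open>Moving \<open>Q\<close> onto \<open>P\<close> moves \<open>H j\<close>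
        along, which places \<open>P\<close> in an intersection that has at least \<open>k\<close>
        cube vertices because \<open>P\<close> does.\<close>
      have PX: "P \<subseteq> H i \<inter> act v ` H j" using P(2) Q(2) v(2) by blast
      then have "H i \<inter> act v ` H j \<in> intersections (H i) (H j) k"
        unfolding intersections_def using has_vertex_count_card_le[OF P(1)] v(1) by blast
      \<comment> \<open>This intersection need not be a chosen one; \<open>u\<close> takes it to its
        representative, and \<open>P\<close> along with it.\<close>
      then obtain s u where s: "s \<in> {1..m}" and u: "u \<in> signed_perms"
        "act u ` (H i \<inter> act v ` H j) = ?I s"
        using representatives_cover[OF reps] by metis
      have R: "has_vertex_count (act u ` P) k" "act u ` P \<subseteq> ?I s"
        using has_vertex_count_act[OF u(1) P(1)] image_mono[OF PX, of "act u"] u(2) by simp_all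
      have "D = ?cl (act u ` P)"
        unfolding P(3) using zero_one_class_eq_iff[OF P(1) R(1)] u(1) by auto
      then have "D = Phi3 (s, ?pcl s (act u ` P))" using Phi3[OF R] by simp
      moreover have "?pcl s (act u ` P) \<in> partial_classes_card (?I s) k"
        using R by (auto simp: partial_classes_card_eq)
      ultimately show "D \<in> Phi3 ` (SIGMA s:{1..m}. partial_classes_card (?I s) k)"
        using s by blast
    qed
  qed
qed

end
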